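(* Let $a,d,h,k$ be positive integers with $\gcd(a,d)=1$ and $2\le k\le a$. Let $q$ and $r$ be the nonnegative integers with $a-1=q(k-1)+r$ and $0\le r<k-1$. Then \begin{align*} s(a,h a+d,\dots,h a+(k-1)d) &=\frac{1}{12 q}\biggl(2 h^2 a q^3(a+2 r-1)\\ &\quad +q^2\Bigl(3 h^2 a(a+3 r-1)+h\bigl(a d(4 a+4 r-5)-d(2 r-1)(r+1)-3 a(a+r-1)\bigr)\Bigr)\\ &\quad +q\Bigl(h^2 a(a+5 r-1)+(a-1)(d-1)(2 a d-a-d-1)\\ &\qquad +3 h\bigl((a+r-1)(d(a+r)-a)-2 d r^2\bigr)\Bigr)\\ &\quad -h d(a-r-1)^2\biggr). \end{align*}
   Context: For positive integers $b_1,\dots,b_m$ with $\gcd(b_1,\dots,b_m)=1$, let $\mathrm{NR}(b_1,\dots,b_m)$ denote the (finite) set of positive integers that cannot be written as $x_1b_1+\cdots+x_mb_m$ with nonnegative integers $x_1,\dots,x_m$. The Sylvester sum is $s(b_1,\dots,b_m)=\sum_{n\in \mathrm{NR}(b_1,\dots,b_m)} n$. The generators in $s(a,ha+d,\dots,ha+(k-1)d)$ are $a_1=a$ and $a_{j+1}=ha+jd$ for $1\le j\le k-1$. *)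

theory Defs
  imports Complex_Main
begin

definition representable :: "nat list \<Rightarrow> nat \<Rightarrow> bool" where
  "representable bs n \<longleftrightarrow> (\<exists>x :: nat \<Rightarrow> nat. n = (\<Sum>i<length bs. x i * bs ! i))"

definition NR :: "nat list \<Rightarrow> nat set" where
  "NR bs = {n. n > 0 \<and> \<not> representable bs n}"

text \<open>The sum is meaningful only if the generators have greatest common divisor 1
  (see \<open>finite_NR\<close> below); it is 0 by convention when \<^term>\<open>NR bs\<close> is infinite.\<close>

definition sylvester_sum :: "nat list \<Rightarrow> nat" where
  "sylvester_sum bs = (\<Sum>n\<in>NR bs. n)"

lemma bezout_list:
  "\<exists>y :: nat \<Rightarrow> int. int (Gcd (set bs)) = (\<Sum>i<length bs. y i * int (bs ! i))"
proof (induction bs)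
  case Nil
  then show ?case by simp
next
  case (Cons b bs)
  then obtain y where y: "int (Gcd (set bs)) = (\<Sum>i<length bs. y i * int (bs ! i))"
    by blast
  obtain u v where uv: "u * int b + v * int (Gcd (set bs)) = gcd (int b) (int (Gcd (set bs)))"
    using bezout_int by blast
  define z where "z = (\<lambda>i. case i of 0 \<Rightarrow> u | Suc j \<Rightarrow> v * y j)"
  have "(\<Sum>i<length (b # bs). z i * int ((b # bs) ! i))
      = u * int b + v * (\<Sum>i<length bs. y i * int (bs ! i))"
    by (simp add: z_def sum.lessThan_Suc_shift sum_distrib_left mult.assoc del: sum.lessThan_Suc)
  also have "\<dots> = int (Gcd (set (b # bs)))"
    unfolding y[symmetric] using uv by simp
  finally show ?case by metis
qed

lemma finite_NR:
  assumes "Gcd (set bs) = 1"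
  shows "finite (NR bs)"
proof -
  obtain y where y: "(\<Sum>i<length bs. y i * int (bs ! i)) = 1"
    using bezout_list[of bs] assms by (metis of_nat_1)
  obtain k where k: "k < length bs" "bs ! k > 0"
  proof -
    have "\<exists>k<length bs. bs ! k > 0"
    proof (rule ccontr)
      assume "\<not> (\<exists>k<length bs. bs ! k > 0)"
      then have "(\<Sum>i<length bs. y i * int (bs ! i)) = 0"
        by (intro sum.neutral) auto
      with y show False by simp
    qed
    with that show thesis by blast
  qed
  define b where "b = bs ! k"
  define L where "L = int b * (\<Sum>i<length bs. \<bar>y i\<bar>)"
  define M where "M = nat (L * (\<Sum>i<length bs. int (bs ! i)))"
  have L: "L \<ge> 0" unfolding L_def by (intro mult_nonneg_nonneg sum_nonneg) auto
  have M: "int M = L * (\<Sum>i<length bs. int (bs ! i))"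
    unfolding M_def using L by (simp add: sum_nonneg)
  have "representable bs n" if n: "n \<ge> M" for n
  proof -
    define t where "t = (n - M) mod b"
    define q where "q = (n - M) div b"
    define x where "x = (\<lambda>i. L + int t * y i + (if i = k then int q else 0))"
    have tb: "t < b" using k by (simp add: t_def b_def)
    have x: "x i \<ge> 0" if "i < length bs" for i
    proof -
      have "\<bar>y i\<bar> \<le> (\<Sum>i<length bs. \<bar>y i\<bar>)"
        using that by (intro member_le_sum) auto
      then have "int t * \<bar>y i\<bar> \<le> L"
        unfolding L_def using tb by (intro mult_mono) auto
      moreover have "int t * \<bar>y i\<bar> = \<bar>int t * y i\<bar>"
        by (simp add: abs_mult)
      ultimately show ?thesis unfolding x_def by auto
    qed
    have "(\<Sum>i<length bs. x i * int (bs ! i))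
        = (\<Sum>i<length bs. L * int (bs ! i) + int t * (y i * int (bs ! i))
            + (if i = k then int q * int (bs ! i) else 0))"
      by (intro sum.cong) (auto simp: x_def algebra_simps)
    also have "\<dots> = int M + int t + int q * int b"
      using k y M by (simp add: sum.distrib b_def flip: sum_distrib_left)
    also have "\<dots> = int n"
    proof -
      have "M + t + q * b = n"
        using n by (simp add: t_def q_def add.assoc)
      then show ?thesis by (metis of_nat_add of_nat_mult)
    qed
    finally have "int n = (\<Sum>i<length bs. x i * int (bs ! i))" by simp
    also have "\<dots> = int (\<Sum>i<length bs. nat (x i) * bs ! i)"
      using x by simp
    finally have "n = (\<Sum>i<length bs. nat (x i) * bs ! i)"
      by (simp only: of_nat_eq_iff)
    then show ?thesis
      unfolding representable_def by (intro exI[of _ "\<lambda>i. nat (x i)"])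
  qed
  then have "NR bs \<subseteq> {..<M}"
    unfolding NR_def by (auto simp: lessThan_iff) (meson not_le_imp_less)
  then show ?thesis using finite_subset by blast
qed

end

theory Submission
  imports Defs "HOL-Number_Theory.Cong"
begin

text \<open>For a semigroup containing \<open>a\<close>, the gaps in a given residue class modulo \<open>a\<close> are the
  numbers of that class below its smallest representable member. For the generators
  \<open>a, ha + d, \<dots>, ha + (k - 1)d\<close> the smallest representable member of the class of \<open>i d\<close>, \<open>i < a\<close>,
  is \<open>h a c + i d\<close>, where \<open>c\<close> is \<open>i / (k - 1)\<close> rounded up, because with \<open>m\<close> of the last \<open>k - 1\<close>
  generators one reaches exactly the numbers \<open>m h a + S d\<close> with \<open>m \<le> S \<le> (k - 1) m\<close>. The Sylvester
  sum is therefore determined by the first two power sums of these minima.\<close>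

section \<open>Sylvester sums from minimal residue representatives\<close>

text \<open>With \<open>w = a * t + c\<close> the summands are \<open>a * j + c\<close> for
  \<open>j < t\<close>, so twice the sum is \<open>a * t * (t - 1) + 2 * c * t\<close>. Multiplying
  by \<open>a\<close> as well lets \<open>a * t = w - c\<close> eliminate the quotient
  \<open>t\<close>.\<close>

lemma sum_below_residue:
  fixes a w :: nat
  assumes "a > 0"
  shows "2 * int a * int (\<Sum>{n. n < w \<and> n mod a = w mod a}) =
    (int w)\<^sup>2 - int a * int w + int a * int (w mod a) - (int (w mod a))\<^sup>2"
proof -
  define c t where "c = w mod a" and "t = w div a"
  have w: "w = a * t + c" and c: "c < a"
    using assms by (simp_all add: c_def t_def)
  have "{n. n < w \<and> n mod a = w mod a} = (\<lambda>j. a * j + c) ` {..<t}" (is "?L = ?R")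
  proof
    show "?R \<subseteq> ?L"
      using c assms by (auto simp: w)
    show "?L \<subseteq> ?R"
    proof
      fix n assume n: "n \<in> ?L"
      then have "n = a * (n div a) + c"
        by (simp add: c_def) (metis mult_div_mod_eq)
      moreover from this have "n div a < t"
        using n w by (metis (no_types, lifting) add_less_cancel_right mem_Collect_eq mult_less_cancel1)
      ultimately show "n \<in> ?R" by blast
    qed
  qed
  moreover have "inj_on (\<lambda>j. a * j + c) {..<t}"
    using assms by (auto intro: inj_onI)
  ultimately have "\<Sum>{n. n < w \<and> n mod a = w mod a} = (\<Sum>j<t. a * j + c)"
    by (simp add: sum.reindex)
  moreover have "2 * int (\<Sum>j<t. a * j + c) = int a * int t * (int t - 1) + 2 * int c * int t"
    by (induction t) (auto simp: algebra_simps)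
  ultimately have "2 * int a * int (\<Sum>{n. n < w \<and> n mod a = w mod a}) =
      int a * (int a * int t * (int t - 1) + 2 * int c * int t)"
    by simp
  also have "\<dots> = (int w)\<^sup>2 - int a * int w + int a * int c - (int c)\<^sup>2"
    unfolding w by (simp add: algebra_simps power2_eq_square)
  finally show ?thesis unfolding c_def .
qed

lemma representable_0: "representable bs 0"
  unfolding representable_def by (intro exI[of _ "\<lambda>_. 0"]) simp

text \<open>The gaps split into one class per \<open>i\<close>, each summed by
  \<open>sum_below_residue\<close>. The residues \<open>w i mod a\<close> run once through all of
  \<open>{..<a}\<close>, so their contribution does not depend on \<open>w\<close>; it is the last
  term.\<close>

lemma sylvester_sum_residue_minima:
  fixes w :: "'i \<Rightarrow> nat"
  assumes "a > 0"
    and bij: "bij_betw (\<lambda>i. w i mod a) I {..<a}"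
    and rep: "\<And>n i. i \<in> I \<Longrightarrow> n mod a = w i mod a \<Longrightarrow> representable bs n \<longleftrightarrow> w i \<le> n"
  shows "12 * int a * int (sylvester_sum bs) =
    6 * (\<Sum>i\<in>I. (int (w i))\<^sup>2) - 6 * int a * (\<Sum>i\<in>I. int (w i)) + int a * ((int a)\<^sup>2 - 1)"
proof -
  define G where "G i = {n. n < w i \<and> n mod a = w i mod a}" for i
  have fin: "finite I"
    using bij bij_betw_finite by blast
  have "NR bs = (\<Union>i\<in>I. G i)"
  proof (intro equalityI subsetI)
    fix n assume n: "n \<in> NR bs"
    have "n mod a \<in> (\<lambda>i. w i mod a) ` I"
      using bij \<open>a > 0\<close> by (simp add: bij_betw_def)
    then obtain i where "i \<in> I" "n mod a = w i mod a" by blast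
    with n rep show "n \<in> (\<Union>i\<in>I. G i)"
      unfolding NR_def G_def by (force simp: not_le)
  next
    fix n assume "n \<in> (\<Union>i\<in>I. G i)"
    then have "\<not> representable bs n"
      using rep by (auto simp: G_def)
    then show "n \<in> NR bs"
      unfolding NR_def using representable_0 by (metis (mono_tags, lifting) gr0I mem_Collect_eq)
  qed
  moreover have "finite (G i)" for i by (simp add: G_def)
  moreover have "G i \<inter> G j = {}" if "i \<in> I" "j \<in> I" "i \<noteq> j" for i j
    using bij that by (auto simp: G_def bij_betw_def inj_on_def)
  ultimately have "sylvester_sum bs = (\<Sum>i\<in>I. \<Sum>(G i))"
    unfolding sylvester_sum_def using fin by (simp add: sum.UNION_disjoint)
  then have "2 * int a * int (sylvester_sum bs) = (\<Sum>i\<in>I. 2 * int a * int (\<Sum>(G i)))"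
    by (simp add: sum_distrib_left)
  also have "\<dots> = (\<Sum>i\<in>I. (int (w i))\<^sup>2 - int a * int (w i)
      + (int a * int (w i mod a) - (int (w i mod a))\<^sup>2))"
    unfolding G_def by (intro sum.cong refl) (simp only: sum_below_residue[OF \<open>a > 0\<close>])
  also have "\<dots> = (\<Sum>i\<in>I. (int (w i))\<^sup>2) - int a * (\<Sum>i\<in>I. int (w i))
      + (\<Sum>i\<in>I. int a * int (w i mod a) - (int (w i mod a))\<^sup>2)"
    by (simp add: sum.distrib sum_subtractf sum_distrib_left)
  also have "(\<Sum>i\<in>I. int a * int (w i mod a) - (int (w i mod a))\<^sup>2)
      = (\<Sum>c<a. int a * int c - (int c)\<^sup>2)"
    by (rule sum.reindex_bij_betw[OF bij, of "\<lambda>c. int a * int c - (int c)\<^sup>2"])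
  finally have *: "2 * int a * int (sylvester_sum bs) = (\<Sum>i\<in>I. (int (w i))\<^sup>2)
      - int a * (\<Sum>i\<in>I. int (w i)) + (\<Sum>c<a. int a * int c - (int c)\<^sup>2)" .
  \<comment> \<open>The upper limit is separated from the coefficient \<open>a\<close> to make
    induction possible.\<close>
  have "6 * (\<Sum>c<m. int a * int c - (int c)\<^sup>2)
      = 3 * int a * int m * (int m - 1) - int m * (int m - 1) * (2 * int m - 1)" for m
    by (induction m) (auto simp: algebra_simps power2_eq_square)
  from this[of a] have "6 * (\<Sum>c<a. int a * int c - (int c)\<^sup>2) = int a * ((int a)\<^sup>2 - 1)"
    by (simp add: algebra_simps power2_eq_square)
  with * show ?thesis by (simp add: algebra_simps)
qed

section \<open>Almost arithmetic sequences of generators\<close>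

lemma representable_add:
  assumes "representable bs m" "representable bs n"
  shows "representable bs (m + n)"
proof -
  from assms obtain x y where "m = (\<Sum>i<length bs. x i * bs ! i)" "n = (\<Sum>i<length bs. y i * bs ! i)"
    unfolding representable_def by blast
  then show ?thesis
    unfolding representable_def
    by (intro exI[of _ "\<lambda>i. x i + y i"]) (simp add: sum.distrib algebra_simps)
qed

lemma representable_member:
  assumes "b \<in> set bs"
  shows "representable bs b"
proof -
  from assms obtain j where "j < length bs" "bs ! j = b"
    by (meson in_set_conv_nth)
  then show ?thesis
    unfolding representable_def
    by (intro exI[of _ "\<lambda>i. if i = j then 1 else 0"]) (simp add: if_distrib[of "\<lambda>x. x * _"] cong: if_cong)
qed

lemma representable_mult:
  assumes "representable bs b"
  shows "representable bs (x * b)"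
  by (induction x) (auto intro: representable_0 representable_add assms)

text \<open>Here \<open>m\<close> counts the generators used other than the leading
  \<open>a\<close>, with multiplicity, and \<open>S\<close> adds up their indices \<open>j\<close>.
  Each index lies between 1 and \<open>K\<close>, hence the bounds on \<open>S\<close>; conversely,
  any such \<open>S\<close> is split greedily into \<open>m\<close> indices.\<close>

lemma representable_progression_iff:
  fixes a d h K n :: nat
  defines "bs \<equiv> a # map (\<lambda>j. h * a + j * d) [1..<Suc K]"
  shows "representable bs n \<longleftrightarrow> (\<exists>x m S. n = x * a + m * h * a + S * d \<and> m \<le> S \<and> S \<le> K * m)"
proof
  assume "representable bs n"
  then obtain x where "n = (\<Sum>i<length bs. x i * bs ! i)"
    unfolding representable_def by blast
  moreover have "length bs = Suc K"
    by (simp add: bs_def)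
  ultimately have "n = (\<Sum>i<Suc K. x i * bs ! i)"
    by simp
  also have "\<dots> = x 0 * a + (\<Sum>i<K. x (Suc i) * (h * a + Suc i * d))"
    unfolding sum.lessThan_Suc_shift by (simp add: bs_def del: upt_Suc)
  also have "\<dots> = x 0 * a + (\<Sum>i<K. x (Suc i)) * h * a + (\<Sum>i<K. Suc i * x (Suc i)) * d"
    by (simp add: sum_distrib_right sum_distrib_left sum.distrib algebra_simps)
  finally have "n = x 0 * a + (\<Sum>i<K. x (Suc i)) * h * a + (\<Sum>i<K. Suc i * x (Suc i)) * d" .
  moreover have "(\<Sum>i<K. x (Suc i)) \<le> (\<Sum>i<K. Suc i * x (Suc i))"
    by (intro sum_mono) simp
  moreover have "(\<Sum>i<K. Suc i * x (Suc i)) \<le> K * (\<Sum>i<K. x (Suc i))"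
    unfolding sum_distrib_left by (intro sum_mono mult_right_mono) auto
  ultimately show "\<exists>x m S. n = x * a + m * h * a + S * d \<and> m \<le> S \<and> S \<le> K * m"
    by blast
next
  assume "\<exists>x m S. n = x * a + m * h * a + S * d \<and> m \<le> S \<and> S \<le> K * m"
  then obtain x m S where n: "n = x * a + m * h * a + S * d" and "m \<le> S" "S \<le> K * m"
    by blast
  from this(2,3) have "representable bs (m * h * a + S * d)"
  proof (induction m arbitrary: S)
    case 0
    then show ?case by (simp add: representable_0)
  next
    case (Suc m)
    \<comment> \<open>The largest admissible index that leaves at least 1 for each of the other
      \<open>m\<close> generators.\<close>
    define j where "j = min K (S - m)"
    have "K > 0" using Suc.prems by (cases K) auto
    have j: "1 \<le> j" "j \<le> K" "j \<le> S"
      using Suc.prems \<open>K > 0\<close> by (auto simp: j_def)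
    have "m \<le> S - j" "S - j \<le> K * m"
    proof -
      show "m \<le> S - j" using Suc.prems by (auto simp: j_def)
      have "m \<le> K * m" using \<open>K > 0\<close> by simp
      then show "S - j \<le> K * m" using Suc.prems by (auto simp: j_def min_def)
    qed
    then have "representable bs (m * h * a + (S - j) * d)"
      by (rule Suc.IH)
    moreover have "h * a + j * d \<in> set bs"
      using j by (auto simp: bs_def)
    ultimately have "representable bs ((m * h * a + (S - j) * d) + (h * a + j * d))"
      by (rule representable_add[OF _ representable_member])
    moreover have "(m * h * a + (S - j) * d) + (h * a + j * d) = Suc m * h * a + ((S - j) + j) * d"
      by (simp add: algebra_simps)
    ultimately show ?case using j by simp
  qed
  moreover have "representable bs (x * a)"
    by (intro representable_mult representable_member) (simp add: bs_def)
  ultimately show "representable bs n"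
    unfolding n using representable_add by (metis add.assoc)
qed

text \<open>The residue class forces \<open>S\<close> to be congruent to \<open>i\<close>, so
  \<open>S\<close> is at least \<open>i\<close> because \<open>i < a\<close>; then
  \<open>K * m\<close> is at least \<open>i\<close>, so \<open>m\<close> is at least the ceiling of
  \<open>i / K\<close>, which is \<open>(i + K - 1) div K\<close>. Taking both minimal gives
  \<open>w\<close>, and copies of \<open>a\<close> fill the rest.\<close>

lemma representable_progression_residue:
  fixes a d h K n i :: nat
  defines "w \<equiv> h * a * ((i + K - 1) div K) + i * d"
  assumes "K > 0" "coprime a d" "i < a" and n: "n mod a = w mod a"
  shows "representable (a # map (\<lambda>j. h * a + j * d) [1..<Suc K]) n \<longleftrightarrow> w \<le> n"
  unfolding representable_progression_iff
proof
  assume "\<exists>x m S. n = x * a + m * h * a + S * d \<and> m \<le> S \<and> S \<le> K * m"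
  then obtain x m S where nx: "n = x * a + m * h * a + S * d" and S: "S \<le> K * m"
    by blast
  have "[S * d = i * d] (mod a)"
  proof -
    have "n = (x + m * h) * a + S * d" "w = (h * ((i + K - 1) div K)) * a + i * d"
      by (simp_all add: nx w_def algebra_simps)
    then have "n mod a = S * d mod a" "w mod a = i * d mod a"
      by (metis mod_mult_self3)+
    with n show ?thesis by (simp add: cong_def)
  qed
  then have "[S = i] (mod a)"
    using \<open>coprime a d\<close> by (meson cong_mult_rcancel_nat coprime_commute)
  then have "i \<le> S"
    using \<open>i < a\<close> by (metis cong_def mod_less mod_less_eq_dividend)
  moreover have "(i + K - 1) div K \<le> m"
  proof -
    have "i + K - 1 < Suc m * K"
      using \<open>i \<le> S\<close> S \<open>K > 0\<close> by (simp add: algebra_simps)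
    then show ?thesis
      by (simp add: less_mult_imp_div_less less_Suc_eq_le[symmetric])
  qed
  ultimately have "h * a * ((i + K - 1) div K) + i * d \<le> h * a * m + S * d"
    by (intro add_mono mult_mono) auto
  then show "w \<le> n"
    by (simp add: w_def nx algebra_simps)
next
  assume "w \<le> n"
  with n obtain x where x: "n = w + a * x"
    by (metis le_add_diff_inverse mod_eq_dvd_iff_nat dvdE)
  define c where "c = (i + K - 1) div K"
  have "i \<le> K * c"
  proof -
    have "i + K - 1 < K * c + K"
      using dividend_less_times_div[of K "i + K - 1"] \<open>K > 0\<close> by (simp add: c_def)
    then show ?thesis by linarith
  qed
  \<comment> \<open>This is the condition \<open>m \<le> S\<close> for the witnesses
    \<open>m = c\<close>, \<open>S = i\<close>.\<close>
  moreover have "c \<le> i"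
  proof (cases i)
    case 0
    then show ?thesis using \<open>K > 0\<close> by (simp add: c_def)
  next
    case (Suc j)
    have "c \<le> j + 1"
      using \<open>K > 0\<close> by (simp add: c_def Suc)
    then show ?thesis by (simp add: Suc)
  qed
  moreover have "n = x * a + c * h * a + i * d"
    by (simp add: x w_def c_def algebra_simps)
  ultimately show "\<exists>x m S. n = x * a + m * h * a + S * d \<and> m \<le> S \<and> S \<le> K * m"
    by blast
qed

section \<open>Power sums of the minima\<close>

text \<open>The case \<open>r = K\<close> is allowed on purpose: it appends a complete block, which
  is the induction step for the sums over \<open>p * K\<close>.\<close>

lemma sum_div_blocks:
  fixes f :: "nat \<Rightarrow> nat \<Rightarrow> 'b :: comm_monoid_add"
  assumes "r \<le> K"
  shows "(\<Sum>j<q * K + r. f (j div K) j) = (\<Sum>j<q * K. f (j div K) j) + (\<Sum>j<r. f q (q * K + j))"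
  using assms by (induction r) (auto simp: add.assoc)

text \<open>With \<open>i = j + 1\<close>, the value \<open>j div K + 1\<close> is the ceiling of
  \<open>i / K\<close>. It is constant on each of \<open>q\<close> blocks of length \<open>K\<close>
  and equals \<open>q + 1\<close> on the \<open>r\<close> remaining indices.\<close>

lemma sums_div_blocks:
  fixes K q r :: nat
  assumes "r \<le> K"
  shows "2 * (\<Sum>j<q * K + r. int (j div K) + 1) = int K * q * (q + 1) + 2 * int r * (q + 1)"
    and "6 * (\<Sum>j<q * K + r. (int (j div K) + 1)\<^sup>2)
      = int K * q * (q + 1) * (2 * int q + 1) + 6 * int r * (int q + 1)\<^sup>2"
    and "12 * (\<Sum>j<q * K + r. (int (j div K) + 1) * (int j + 1))
      = 4 * (int K)\<^sup>2 * (int q - 1) * q * (q + 1) + 3 * int K * (int K + 1) * q * (q + 1)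
        + 6 * (int q + 1) * (2 * int r * q * K + int r * (int r + 1))"
proof -
  note split = sum_div_blocks[where f = "\<lambda>c j. int c + 1"]
    sum_div_blocks[where f = "\<lambda>c j. (int c + 1)\<^sup>2"]
    sum_div_blocks[where f = "\<lambda>c j. (int c + 1) * (int j + 1)"]
  \<comment> \<open>Used with \<open>m = K\<close> for a complete block and with
    \<open>m = r\<close> for the remainder.\<close>
  have tail: "2 * (\<Sum>j<m. (int p + 1) * (int (p * K + j) + 1))
      = (int p + 1) * (2 * int m * p * K + int m * (int m + 1))" for p m
    by (induction m) (auto simp: algebra_simps)
  have mult_Suc: "Suc p * K = p * K + K" for p by simp
  have "2 * (\<Sum>j<p * K. int (j div K) + 1) = int K * p * (p + 1)" for p
  proof (induction p)
    case (Suc p)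
    then show ?case unfolding mult_Suc split[OF order.refl] by (simp add: algebra_simps)
  qed simp
  from this[of q] show "2 * (\<Sum>j<q * K + r. int (j div K) + 1) = int K * q * (q + 1) + 2 * int r * (q + 1)"
    unfolding split[OF assms] by (simp add: algebra_simps)
  have "6 * (\<Sum>j<p * K. (int (j div K) + 1)\<^sup>2) = int K * p * (p + 1) * (2 * int p + 1)" for p
  proof (induction p)
    case (Suc p)
    then show ?case unfolding mult_Suc split[OF order.refl]
      by (simp add: algebra_simps power2_eq_square)
  qed simp
  from this[of q] show "6 * (\<Sum>j<q * K + r. (int (j div K) + 1)\<^sup>2)
      = int K * q * (q + 1) * (2 * int q + 1) + 6 * int r * (int q + 1)\<^sup>2"
    unfolding split[OF assms] by (simp add: algebra_simps)
  have "12 * (\<Sum>j<p * K. (int (j div K) + 1) * (int j + 1))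
      = 4 * (int K)\<^sup>2 * (int p - 1) * p * (p + 1) + 3 * int K * (int K + 1) * p * (p + 1)" for p
  proof (induction p)
    case (Suc p)
    then show ?case unfolding mult_Suc split[OF order.refl] ring_distribs(1)[of 12] using tail[of p K]
      by (simp add: algebra_simps power2_eq_square)
  qed simp
  from this[of q] show "12 * (\<Sum>j<q * K + r. (int (j div K) + 1) * (int j + 1))
      = 4 * (int K)\<^sup>2 * (int q - 1) * q * (q + 1) + 3 * int K * (int K + 1) * q * (q + 1)
        + 6 * (int q + 1) * (2 * int r * q * K + int r * (int r + 1))"
    unfolding split[OF assms] using tail[of q r] by (simp add: algebra_simps)
qed

theorem theorem2:
  fixes a d h k q r :: nat
  assumes "a > 0" and "d > 0" and "h > 0" and "k > 0"
    and "gcd a d = 1"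
    and "2 \<le> k" and "k \<le> a"
    and "a - 1 = q * (k - 1) + r" and "r < k - 1"
  shows "real (sylvester_sum (a # map (\<lambda>j. h * a + j * d) [1..<k])) =
    1 / (12 * real q) *
    (2 * (real h)^2 * real a * (real q)^3 * (real a + 2 * real r - 1)
     + (real q)^2 *
         (3 * (real h)^2 * real a * (real a + 3 * real r - 1)
          + real h *
              (real a * real d * (4 * real a + 4 * real r - 5)
               - real d * (2 * real r - 1) * (real r + 1)
               - 3 * real a * (real a + real r - 1)))
     + real q *
         ((real h)^2 * real a * (real a + 5 * real r - 1)
          + (real a - 1) * (real d - 1) * (2 * real a * real d - real a - real d - 1)
          + 3 * real h *
              ((real a + real r - 1) * (real d * (real a + real r) - real a)
               - 2 * real d * (real r)^2))
     - real h * real d * (real a - real r - 1)^2)"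
proof -
  define K where "K = k - 1"
  define C where "C i = (i + K - 1) div K" for i
  define w where "w i = h * a * C i + i * d" for i
  define s where "s = sylvester_sum (a # map (\<lambda>j. h * a + j * d) [1..<k])"
  have "K > 0" and k: "k = Suc K" using assms by (auto simp: K_def)
  have aq: "a = Suc (q * K + r)" and "r \<le> K" using assms by (auto simp: K_def)
  \<comment> \<open>If \<open>q\<close> were 0, then \<open>a - 1 = r < k - 1\<close> would
    contradict \<open>k \<le> a\<close>.\<close>
  have "q > 0" using assms by (intro gr0I) auto
  have "coprime a d" using assms(5) by (simp only: coprime_iff_gcd_eq_1)
  \<comment> \<open>Modulo \<open>a\<close>, \<open>w i\<close> is \<open>i * d\<close>, and
    \<open>d\<close> is invertible.\<close>
  have "bij_betw (\<lambda>i. w i mod a) {..<a} {..<a}"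
  proof -
    have "inj_on (\<lambda>i. w i mod a) {..<a}"
    proof (rule inj_onI)
      fix i j assume ij: "i \<in> {..<a}" "j \<in> {..<a}" and "w i mod a = w j mod a"
      moreover have "w i mod a = i * d mod a" for i
        unfolding w_def by (metis mod_mult_self3 mult.assoc mult.commute)
      ultimately have "[i * d = j * d] (mod a)" by (simp add: cong_def)
      then have "[i = j] (mod a)"
        using \<open>coprime a d\<close> by (meson cong_mult_rcancel_nat coprime_commute)
      then show "i = j" using ij by (simp add: cong_def)
    qed
    moreover have "(\<lambda>i. w i mod a) ` {..<a} \<subseteq> {..<a}" using assms by auto
    ultimately show ?thesis
      by (metis bij_betw_def endo_inj_surj finite_lessThan)
  qed
  then have s12: "12 * int a * int s = 6 * (\<Sum>i<a. (int (w i))\<^sup>2)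
      - 6 * int a * (\<Sum>i<a. int (w i)) + int a * ((int a)\<^sup>2 - 1)"
    unfolding s_def k
  proof (rule sylvester_sum_residue_minima[OF assms(1)])
    fix n i assume "i \<in> {..<a}" "n mod a = w i mod a"
    then show "representable (a # map (\<lambda>j. h * a + j * d) [1..<Suc K]) n \<longleftrightarrow> w i \<le> n"
      using \<open>K > 0\<close> \<open>coprime a d\<close>
      unfolding w_def C_def by (intro representable_progression_residue) simp_all
  qed
  \<comment> \<open>The index 0 drops out of all three sums below, and the shift
    \<open>i = Suc j\<close> brings the others into the form of
    \<open>sums_div_blocks\<close>.\<close>
  have C0: "C 0 = 0" using \<open>K > 0\<close> by (simp add: C_def)
  have CS: "int (C (Suc j)) = int (j div K) + 1" for j
    using \<open>K > 0\<close> by (simp add: C_def)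
  define C1 C2 CI where "C1 = (\<Sum>i<a. int (C i))" and "C2 = (\<Sum>i<a. (int (C i))\<^sup>2)"
    and "CI = (\<Sum>i<a. int (C i) * int i)"
  have C1: "2 * C1 = int K * q * (q + 1) + 2 * int r * (q + 1)"
    using sums_div_blocks(1)[OF \<open>r \<le> K\<close>, of q]
    by (simp add: C1_def aq sum.lessThan_Suc_shift C0 CS del: sum.lessThan_Suc)
  have C2: "6 * C2 = int K * q * (q + 1) * (2 * int q + 1) + 6 * int r * (int q + 1)\<^sup>2"
    using sums_div_blocks(2)[OF \<open>r \<le> K\<close>, of q]
    by (simp add: C2_def aq sum.lessThan_Suc_shift C0 CS del: sum.lessThan_Suc)
  have CI: "12 * CI = 4 * (int K)\<^sup>2 * (int q - 1) * q * (q + 1)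
      + 3 * int K * (int K + 1) * q * (q + 1)
      + 6 * (int q + 1) * (2 * int r * q * K + int r * (int r + 1))"
    using sums_div_blocks(3)[OF \<open>r \<le> K\<close>, of q]
    by (simp add: CI_def aq sum.lessThan_Suc_shift C0 CS add.commute del: sum.lessThan_Suc)
  have I1: "2 * (\<Sum>i<m. int i) = int m * (int m - 1)"
    and I2: "6 * (\<Sum>i<m. (int i)\<^sup>2) = int m * (int m - 1) * (2 * int m - 1)" for m
    by (induction m) (auto simp: algebra_simps power2_eq_square)
  have W1: "2 * (\<Sum>i<a. int (w i)) = 2 * int h * a * C1 + int d * (int a * (int a - 1))"
    unfolding I1[symmetric] C1_def
    by (simp add: w_def sum.distrib sum_distrib_left algebra_simps)
  have "(\<Sum>i<a. (int (w i))\<^sup>2)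
      = (int h)\<^sup>2 * (int a)\<^sup>2 * C2 + 2 * int h * a * d * CI + (int d)\<^sup>2 * (\<Sum>i<a. (int i)\<^sup>2)"
    unfolding C2_def CI_def sum_distrib_left sum.distrib[symmetric]
    by (intro sum.cong) (auto simp: w_def algebra_simps power2_eq_square)
  then have W2: "6 * (\<Sum>i<a. (int (w i))\<^sup>2) = 6 * (int h)\<^sup>2 * (int a)\<^sup>2 * C2
      + 12 * int h * a * d * CI + (int d)\<^sup>2 * (int a * (int a - 1) * (2 * int a - 1))"
    unfolding I2[symmetric] by (simp add: algebra_simps)
  \<comment> \<open>Every term of the power sums of \<open>w\<close> carries a factor
    \<open>a\<close>, from \<open>h * a\<close> or from the closed forms for the sums of
    \<open>i\<close> and its square, so \<open>a\<close> can be cancelled.\<close>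
  have "int a * (12 * int s) = int a * (6 * (int h)\<^sup>2 * a * C2 + 12 * int h * d * CI
      + (int d)\<^sup>2 * (int a - 1) * (2 * int a - 1) - 6 * int h * a * C1
      - 3 * int d * a * (int a - 1) + (int a)\<^sup>2 - 1)"
    using s12 W2 arg_cong[OF W1, of "(*) (3 * int a)"]
    by (simp add: algebra_simps power2_eq_square)
  then have "12 * int s = 6 * (int h)\<^sup>2 * a * C2 + 12 * int h * d * CI
      + (int d)\<^sup>2 * (int a - 1) * (2 * int a - 1) - 6 * int h * a * C1
      - 3 * int d * a * (int a - 1) + (int a)\<^sup>2 - 1"
    using assms(1) by (subst (asm) mult_cancel_left) simp
  \<comment> \<open>Regrouped so that the left-hand sides of \<open>C1\<close>, \<open>C2\<close>
    and \<open>CI\<close> occur literally.\<close>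
  then have "12 * int s = int a * (int h)\<^sup>2 * (6 * C2) + int h * d * (12 * CI)
      + (int d)\<^sup>2 * (int a - 1) * (2 * int a - 1) - 3 * int h * a * (2 * C1)
      - 3 * int d * a * (int a - 1) + (int a)\<^sup>2 - 1"
    by (simp add: algebra_simps)
  from arg_cong[OF this[unfolded C1 C2 CI], of real_of_int]
  have s: "12 * real s = real a * (real h)\<^sup>2 *
        (real K * q * (q + 1) * (2 * real q + 1) + 6 * real r * (real q + 1)\<^sup>2)
      + real h * d * (4 * (real K)\<^sup>2 * (real q - 1) * q * (q + 1)
        + 3 * real K * (real K + 1) * q * (q + 1)
        + 6 * (real q + 1) * (2 * real r * q * K + real r * (real r + 1)))
      + (real d)\<^sup>2 * (real a - 1) * (2 * real a - 1)
      - 3 * real h * a * (real K * q * (q + 1) + 2 * real r * (q + 1))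
      - 3 * real d * a * (real a - 1) + (real a)\<^sup>2 - 1"
    by simp
  \<comment> \<open>The denominator \<open>q\<close> in the claim comes from expressing
    \<open>K\<close> as \<open>(a - 1 - r) / q\<close>. Eliminating \<open>a\<close> instead of
    \<open>K\<close> leaves, after the common factor \<open>1 / (12 * q)\<close>, an identity of
    polynomials in \<open>q\<close>, \<open>K\<close>, \<open>r\<close>, \<open>h\<close> and
    \<open>d\<close>.\<close>
  have ra: "real a = real q * K + r + 1" by (simp add: aq)
  have "real s = 1 / (12 * real q) * (real q * (12 * real s))"
    using \<open>q > 0\<close> by simp
  then show ?thesis
    unfolding s_def[symmetric] s unfolding ra
    by (simp add: algebra_simps power2_eq_square power3_eq_cube)
qed

end
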